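(* For every integer $n\ge 0$, the associated Hermite polynomial $H_n(x;c+1)$ is the generating function (sum over matchings of the product of weights) for those connected incomplete matchings on the vertices $\{1,\dots,n+2\}$ such that vertex $1$ lies in an edge (called the fake edge), every fixed point is nested by the fake edge, and every edge other than the fake edge either crosses the fake edge or is nested by the fake edge, with the following weights: the fake edge has weight $1$; fixed points have weight $x$; non-nested edges other than the fake edge have weight $-c$; nested edges have weight $-1$.
   Context: The associated Hermite polynomials are defined by $H_0(x;c)=1$, $H_m(x;c)=0$ for $m<0$, and $H_{n+1}(x;c)=xH_n(x;c)-(n-1+c)H_{n-1}(x;c)$ for $n\ge0$; $H_n(x;c+1)$ is obtained by substituting $c+1$ for the indeterminate $c$. An incomplete matching on a set of integers is a partition of it into blocks of size $1$ (fixed points) and blocks of size $2$ (edges), written $(a,b)$ with $a<b$. The edge $(a,b)$ nests a vertex $v$ if $a<v<b$ and nests an edge $(a',b')$ if $a<a'<b'<b$; two edges $(a,b),(a',b')$ cross if $a<a'<b<b'$ or $a'<a<b'<b$. An edge is nested if some other edge nests it, and non-nested otherwise. A matching is connected if every vertex except the first and the last is nested by an edge (this is automatic under the conditions imposed on fixed points and edges in the claim). *)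

theory Defs
  imports "HOL-Computational_Algebra.Polynomial" "HOL-Library.Disjoint_Sets"
begin

text \<open>Elements of \<^typ>\<open>'a poly poly\<close> are polynomials in the indeterminate \<open>x\<close> (outer variable)
  whose coefficients are polynomials in the indeterminate \<open>c\<close> (inner variable).\<close>

definition indet_x :: "'a::comm_ring_1 poly poly"
  where "indet_x = [:0, 1:]"

definition indet_c :: "'a::comm_ring_1 poly poly"
  where "indet_c = [:[:0, 1:]:]"

function assoc_hermite :: "int \<Rightarrow> 'a::comm_ring_1 poly poly"
  where
    "assoc_hermite m =
       (if m < 0 then 0
        else if m = 0 then 1
        else indet_x * assoc_hermite (m - 1) - (of_int (m - 2) + indet_c) * assoc_hermite (m - 2))"
  by auto
termination
  by (relation "Wellfounded.measure nat") auto

declare assoc_hermite.simps [simp del]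

lemma assoc_hermite_neg: "m < 0 \<Longrightarrow> assoc_hermite m = 0"
  by (subst assoc_hermite.simps) simp

lemma assoc_hermite_0: "assoc_hermite 0 = 1"
  by (subst assoc_hermite.simps) simp

lemma assoc_hermite_rec:
  assumes "n \<ge> 0"
  shows "assoc_hermite (n + 1) =
    indet_x * assoc_hermite n - (of_int (n - 1) + indet_c) * assoc_hermite (n - 1)"
  using assms by (subst assoc_hermite.simps) (simp add: algebra_simps)

text \<open>Substitution of \<open>c + 1\<close> for \<open>c\<close>, coefficientwise in \<open>x\<close>.\<close>

definition shift_c :: "'a::comm_ring_1 poly poly \<Rightarrow> 'a poly poly"
  where "shift_c = map_poly (\<lambda>p. pcompose p [:1, 1:])"

definition incomplete_matching :: "nat set \<Rightarrow> nat set set \<Rightarrow> bool"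
  where "incomplete_matching V M \<longleftrightarrow>
    partition_on V M \<and> (\<forall>B\<in>M. card B = 1 \<or> card B = 2)"

definition fixed_points :: "nat set set \<Rightarrow> nat set"
  where "fixed_points M = {v. {v} \<in> M}"

definition edges :: "nat set set \<Rightarrow> (nat \<times> nat) set"
  where "edges M = {(a, b). a < b \<and> {a, b} \<in> M}"

fun nests_vertex :: "nat \<times> nat \<Rightarrow> nat \<Rightarrow> bool"
  where "nests_vertex (a, b) v \<longleftrightarrow> a < v \<and> v < b"

fun nests_edge :: "nat \<times> nat \<Rightarrow> nat \<times> nat \<Rightarrow> bool"
  where "nests_edge (a, b) (a', b') \<longleftrightarrow> a < a' \<and> a' < b' \<and> b' < b"

fun crosses :: "nat \<times> nat \<Rightarrow> nat \<times> nat \<Rightarrow> bool"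
  where "crosses (a, b) (a', b') \<longleftrightarrow>
    (a < a' \<and> a' < b \<and> b < b') \<or> (a' < a \<and> a < b' \<and> b' < b)"

definition nested :: "nat set set \<Rightarrow> nat \<times> nat \<Rightarrow> bool"
  where "nested M e \<longleftrightarrow> (\<exists>e'\<in>edges M - {e}. nests_edge e' e)"

definition connected_matching :: "nat set \<Rightarrow> nat set set \<Rightarrow> bool"
  where "connected_matching V M \<longleftrightarrow>
    (\<forall>v\<in>V - {Min V, Max V}. \<exists>e\<in>edges M. nests_vertex e v)"

fun contains_one :: "nat \<times> nat \<Rightarrow> bool"
  where "contains_one (a, b) \<longleftrightarrow> a = 1 \<or> b = 1"

text \<open>The edge \<open>f\<close> below is the fake edge; it is unique because the blocks of \<open>M\<close> are disjoint.\<close>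

definition hermite_matchings :: "nat \<Rightarrow> nat set set set"
  where "hermite_matchings n = {M.
    incomplete_matching {1..n + 2} M \<and>
    connected_matching {1..n + 2} M \<and>
    (\<exists>f\<in>edges M. contains_one f \<and>
      (\<forall>v\<in>fixed_points M. nests_vertex f v) \<and>
      (\<forall>e\<in>edges M - {f}. crosses e f \<or> nests_edge f e))}"

lemma finite_hermite_matchings: "finite (hermite_matchings n)"
proof (rule finite_subset)
  show "hermite_matchings n \<subseteq> Pow (Pow {1..n + 2})"
    by (auto simp: hermite_matchings_def incomplete_matching_def partition_on_def)
qed simp

definition edge_weight :: "nat set set \<Rightarrow> nat \<times> nat \<Rightarrow> 'a::comm_ring_1 poly poly"
  where "edge_weight M e =
    (if contains_one e then 1 else if nested M e then - 1 else - indet_c)"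

definition matching_weight :: "nat set set \<Rightarrow> 'a::comm_ring_1 poly poly"
  where "matching_weight M =
    (\<Prod>v\<in>fixed_points M. indet_x) * (\<Prod>e\<in>edges M. edge_weight M e)"

end

theory Submission
  imports Defs
begin

text \<open>
  Deleting the fake edge \<open>(1, k)\<close> leaves an incomplete matching of \<open>A \<union> B\<close>, where \<open>A\<close> is the set of
  vertices under the fake edge and \<open>B\<close> the set of those to its right, and the conditions say exactly
  that every block meets \<open>A\<close>. Removing the block of \<open>Max A\<close> does not change which of the other edges
  are nested. The removed block is a fixed point, an edge inside \<open>A\<close> (nested by the fake edge), or
  an edge to some \<open>b \<in> B\<close>, which is nested unless \<open>b = Max B\<close>. Hence the generating function depends
  only on \<open>p = card A\<close> and \<open>q = card B\<close>, and satisfies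
  \<open>X (p + 1) q = x X p q - p X (p - 1) q - (c + q - 1) X p (q - 1)\<close>.
  Summing over \<open>p + q = n\<close> the last two terms combine, since \<open>(p + 1) + (q + c) = n + 1 + c\<close>, and
  give the recurrence of the shifted associated Hermite polynomials.
\<close>

section \<open>The substitution of \<open>c + 1\<close> for \<open>c\<close> in the Hermite
  recurrence\<close>

lemma coeff_shift_c: "coeff (shift_c p) i = pcompose (coeff p i) [:1, 1:]"
  by (simp add: shift_c_def coeff_map_poly)

lemma shift_c_diff: "shift_c (p - q) = shift_c p - shift_c q"
  by (rule poly_eqI) (simp add: coeff_shift_c pcompose_diff)

lemma shift_c_1: "shift_c 1 = 1"
  by (simp add: shift_c_def one_pCons map_poly_pCons pcompose_pCons)

lemma shift_c_indet_x_mult: "shift_c (indet_x * p) = indet_x * shift_c p"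
  by (rule poly_eqI) (simp add: coeff_shift_c indet_x_def coeff_pCons split: nat.splits)

lemma shift_c_indet_c_mult:
  "shift_c ((of_int k + indet_c) * p) = (of_int (k + 1) + indet_c) * shift_c p"
proof (rule poly_eqI)
  \<comment> \<open>The factor is constant in \<open>x\<close>, so it multiplies each coefficient
    separately and only the substitution in \<open>c\<close> remains to be checked.\<close>
  have const: "of_int j + indet_c = [:[:of_int j, 1:] :: 'a poly:]" for j
    by (simp add: indet_c_def of_int_poly)
  show "coeff (shift_c ((of_int k + indet_c) * p)) i
      = coeff ((of_int (k + 1) + indet_c) * shift_c p) i" for i
    unfolding const by (simp add: coeff_shift_c pcompose_mult pcompose_add pcompose_smult pcompose_pCons smult_add_left algebra_simps)
qed

lemma shift_c_assoc_hermite_Suc_Suc: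
  "shift_c (assoc_hermite (int (Suc (Suc n)))) =
    indet_x * shift_c (assoc_hermite (int (Suc n)))
      - (of_nat (Suc n) + indet_c) * shift_c (assoc_hermite (int n))"
proof -
  have "assoc_hermite (int (Suc (Suc n))) = (
      indet_x * assoc_hermite (int (Suc n)) - (of_int (int n) + indet_c) * assoc_hermite (int n) :: 'a poly poly)"
    using assoc_hermite_rec[of "int (Suc n)"] by (simp add: add.commute)
  then show ?thesis
    by (simp only: shift_c_diff shift_c_indet_x_mult shift_c_indet_c_mult) (simp add: add.commute)
qed

section \<open>The two-parameter recurrence and its diagonal sums\<close>

text \<open>\<open>p\<close> counts the vertices under the fake edge, \<open>q\<close> those to its
  right. For \<open>p = 0\<close> no block can meet the vertices under the fake edge, so only the
  empty matching is left, which requires \<open>q = 0\<close>. The truncated \<open>p - 1\<close> is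
  harmless at \<open>p = 0\<close>, where its coefficient vanishes.\<close>

fun crossing_gf :: "nat \<Rightarrow> nat \<Rightarrow> 'a::comm_ring_1 poly poly"
  where
    "crossing_gf 0 q = (if q = 0 then 1 else 0)"
  | "crossing_gf (Suc p) q = indet_x * crossing_gf p q - of_nat p * crossing_gf (p - 1) q
      - (case q of 0 \<Rightarrow> 0 | Suc r \<Rightarrow> (of_nat r + indet_c) * crossing_gf p r)"

lemma sum_crossing_gf_rec:
  defines "R \<equiv> \<lambda>n. \<Sum>q\<le>n. crossing_gf (n - q) q :: 'a::comm_ring_1 poly poly"
  shows "R (Suc (Suc n)) = indet_x * R (Suc n) - (of_nat (Suc n) + indet_c) * R n"
proof -
  let ?g = "crossing_gf :: nat \<Rightarrow> nat \<Rightarrow> 'a poly poly"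
  \<comment> \<open>The summand at \<open>q = Suc (Suc n)\<close> is
    \<open>crossing_gf 0 q = 0\<close>. In all others the first argument is a successor, so the
    defining equation applies.\<close>
  have "R (Suc (Suc n)) = (\<Sum>q\<le>Suc n. ?g (Suc (Suc n - q)) q)"
    unfolding R_def by (simp add: Suc_diff_le cong: sum.cong_simp)
  also have "\<dots> = indet_x * R (Suc n)
      - (\<Sum>q\<le>Suc n. of_nat (Suc n - q) * ?g (n - q) q)
      - (\<Sum>q\<le>Suc n. case q of 0 \<Rightarrow> 0 | Suc r \<Rightarrow> (of_nat r + indet_c) * ?g (Suc n - q) r)"
    by (simp add: R_def sum_subtractf sum_distrib_left del: sum.atMost_Suc)
  \<comment> \<open>The coefficient is zero at \<open>q = Suc n\<close>.\<close>
  also have "(\<Sum>q\<le>Suc n. of_nat (Suc n - q) * ?g (n - q) q)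
      = (\<Sum>q\<le>n. of_nat (Suc n - q) * ?g (n - q) q)"
    by simp
  \<comment> \<open>The summand at \<open>q = 0\<close> is zero; the others are reindexed by
    \<open>q = Suc r\<close>.\<close>
  also have "(\<Sum>q\<le>Suc n. case q of 0 \<Rightarrow> 0 | Suc r \<Rightarrow> (of_nat r + indet_c) * ?g (Suc n - q) r)
      = (\<Sum>r\<le>n. (of_nat r + indet_c) * ?g (n - r) r)"
    by (subst sum.atMost_Suc_shift) simp
  also have "indet_x * R (Suc n) - (\<Sum>q\<le>n. of_nat (Suc n - q) * ?g (n - q) q)
        - (\<Sum>r\<le>n. (of_nat r + indet_c) * ?g (n - r) r)
      = indet_x * R (Suc n)
        - (\<Sum>q\<le>n. (of_nat (Suc n - q) + of_nat q + indet_c) * ?g (n - q) q)"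
    by (simp add: sum.distrib[symmetric] algebra_simps)
  \<comment> \<open>The truncated subtraction is exact because \<open>q \<le> n\<close>, so the
    coefficient no longer depends on \<open>q\<close>.\<close>
  also have "(\<Sum>q\<le>n. (of_nat (Suc n - q) + of_nat q + indet_c) * ?g (n - q) q)
      = (\<Sum>q\<le>n. (of_nat (Suc n) + indet_c) * ?g (n - q) q)"
    by (rule sum.cong) (simp_all del: of_nat_Suc add: of_nat_add[symmetric])
  also have "\<dots> = (of_nat (Suc n) + indet_c) * R n"
    by (simp add: R_def sum_distrib_left)
  finally show ?thesis .
qed

text \<open>Both sides obey the same two-step recurrence and agree at \<open>0\<close> and
  \<open>1\<close>.\<close>

lemma shift_c_assoc_hermite_eq_sum:
  "shift_c (assoc_hermite (int n)) = (\<Sum>q\<le>n. crossing_gf (n - q) q)"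
proof (induction n rule: induct_nat_012)
  case 0
  show ?case
    by (simp add: shift_c_1 assoc_hermite_0)
next
  case 1
  \<comment> \<open>The second term of the recurrence drops out because
    \<open>assoc_hermite (- 1) = 0\<close>.\<close>
  have "assoc_hermite 1 = (indet_x :: 'a poly poly)"
    using assoc_hermite_rec[of 0, where 'a = 'a] by (simp add: assoc_hermite_0 assoc_hermite_neg)
  then show ?case
    using shift_c_indet_x_mult[of "1 :: 'a poly poly"] by (simp add: shift_c_1)
next
  case (ge2 n)
  then show ?case
    by (simp only: shift_c_assoc_hermite_Suc_Suc sum_crossing_gf_rec)
qed

section \<open>Removing the block of a chosen vertex from a matching\<close>

lemma finite_incomplete_matching:
  assumes "finite V"
  shows "finite {M. incomplete_matching V M \<and> Q M}"
proof (rule finite_subset)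
  show "{M. incomplete_matching V M \<and> Q M} \<subseteq> Pow (Pow V)"
    by (auto simp: incomplete_matching_def partition_on_def)
qed (use assms in simp)

text \<open>Allowing \<open>y = a\<close> lets \<open>{a, y}\<close> stand for a fixed point as well
  as an edge, so both kinds of block are treated at once here and below.\<close>

lemma incomplete_matching_insert:
  assumes "incomplete_matching (V - {a, y}) M" "a \<in> V" "y \<in> V"
  shows "incomplete_matching V (insert {a, y} M)"
  using assms unfolding incomplete_matching_def partition_on_def disjoint_def
  by (auto simp: card_insert_if)

lemma incomplete_matching_remove:
  assumes "incomplete_matching V M" "{a, y} \<in> M"
  shows "incomplete_matching (V - {a, y}) (M - {{a, y}})"
proof -
  have "disjnt {a, y} (\<Union>(M - {{a, y}}))"
    using assms disjointD[of M "{a, y}"]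
    by (fastforce simp: incomplete_matching_def partition_on_def disjnt_def)
  then have "partition_on (V - {a, y}) (M - {{a, y}})"
    using partition_on_insert[of "{a, y}" "M - {{a, y}}" V] assms
    by (auto simp: incomplete_matching_def insert_absorb)
  then show ?thesis using assms by (simp add: incomplete_matching_def)
qed

lemma incomplete_matching_block:
  assumes "incomplete_matching V M" "a \<in> V"
  obtains y where "y \<in> V" "{a, y} \<in> M"
proof -
  obtain E where E: "E \<in> M" "a \<in> E"
    using assms by (auto simp: incomplete_matching_def partition_on_def)
  then have "card E = 1 \<or> card E = 2" and "E \<subseteq> V"
    using assms by (auto simp: incomplete_matching_def partition_on_def)
  then obtain y where "E = {a, y}"
    using E by (auto simp: card_1_singleton_iff card_2_iff insert_commute)
  then show thesis using that E \<open>E \<subseteq> V\<close> by auto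
qed

text \<open>Matchings are classified by the partner \<open>y\<close> of \<open>a\<close>, with
  \<open>y = a\<close> for a fixed point; for each \<open>y\<close>, deleting the block
  \<open>{a, y}\<close> is a bijection.\<close>

lemma sum_incomplete_matching_split:
  assumes "finite V" "a \<in> V"
  shows "(\<Sum>M | incomplete_matching V M \<and> Q M. f M) =
    (\<Sum>y\<in>V. \<Sum>M | incomplete_matching (V - {a, y}) M \<and> Q (insert {a, y} M).
      f (insert {a, y} M))"
proof -
  define S where
    "S = (SIGMA y:V. {M. incomplete_matching (V - {a, y}) M \<and> Q (insert {a, y} M)})"
  define h where "h = (\<lambda>(y, M). insert {a, y} M)"
  \<comment> \<open>No block of \<open>M\<close> contains \<open>a\<close>, so \<open>{a, y}\<close>
    can be recovered from \<open>insert {a, y} M\<close>; this gives injectivity.\<close>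
  have notin: "E \<notin> M" if "(y, M) \<in> S" "a \<in> E" for y M E
    using that by (auto simp: S_def incomplete_matching_def partition_on_def)
  have "inj_on h S"
  proof (rule inj_onI)
    fix s t assume st: "s \<in> S" "t \<in> S" "h s = h t"
    obtain y M y' M' where eq: "s = (y, M)" "t = (y', M')" by (cases s, cases t)
    have ins: "insert {a, y} M = insert {a, y'} M'"
      using st eq by (simp add: h_def)
    have n: "{a, y} \<notin> M" "{a, y} \<notin> M'" using notin st eq by auto
    then have "{a, y} = {a, y'}" using ins by auto
    moreover have "M = M'" using ins n calculation by (metis insert_ident)
    ultimately show "s = t" using eq by (auto simp: doubleton_eq_iff)
  qed
  moreover have "h ` S = {M. incomplete_matching V M \<and> Q M}"
  proof (intro equalityI subsetI)
    fix M assume "M \<in> h ` S"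
    then show "M \<in> {M. incomplete_matching V M \<and> Q M}"
      using assms by (auto simp: h_def S_def incomplete_matching_insert)
  next
    fix M assume "M \<in> {M. incomplete_matching V M \<and> Q M}"
    then have M: "incomplete_matching V M" "Q M" by auto
    obtain y where y: "y \<in> V" "{a, y} \<in> M"
      using incomplete_matching_block[OF M(1) assms(2)] .
    then have "insert {a, y} (M - {{a, y}}) = M" by auto
    then have "(y, M - {{a, y}}) \<in> S" "h (y, M - {{a, y}}) = M"
      using M y incomplete_matching_remove[OF M(1) y(2)] by (auto simp: S_def h_def)
    then show "M \<in> h ` S" by (metis image_eqI)
  qed
  ultimately have "(\<Sum>M | incomplete_matching V M \<and> Q M. f M) = sum (f \<circ> h) S"
    by (metis sum.reindex)
  also have "\<dots> = (\<Sum>y\<in>V. \<Sum>M | incomplete_matching (V - {a, y}) M \<and> Q (insert {a, y} M).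
      f (insert {a, y} M))"
    unfolding S_def using assms finite_incomplete_matching
    by (subst sum.Sigma) (auto simp: h_def split_def)
  finally show ?thesis .
qed

section \<open>Matchings in which every block meets the left set\<close>

text \<open>\<open>M\<close> omits the fake edge: the clause \<open>E \<inter> B = {}\<close> stands for the edges nested by it.\<close>

definition block_weight :: "nat set \<Rightarrow> nat set set \<Rightarrow> nat set \<Rightarrow> 'a::comm_ring_1 poly poly"
  where "block_weight B M E =
    (if card E = 1 then indet_x
     else if E \<inter> B = {} \<or> (\<exists>F\<in>M. \<exists>p\<in>F. \<exists>q\<in>F. \<forall>z\<in>E. p < z \<and> z < q) then - 1
     else - indet_c)"

text \<open>If \<open>E\<close> lies in \<open>A\<close>, the clause on \<open>B\<close> decides.
  Otherwise \<open>E\<close> has elements \<open>u \<le> a < v\<close>, and \<open>{a, y}\<close>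
  would need one element below \<open>u\<close> and one above \<open>v\<close>; \<open>a\<close> is
  neither, and \<open>y\<close> cannot be both.\<close>

lemma block_weight_insert:
  assumes A: "a \<in> A" "\<And>z. z \<in> A \<Longrightarrow> z \<le> a" and AB: "\<And>p q. p \<in> A \<Longrightarrow> q \<in> B \<Longrightarrow> p < q"
    and y: "y \<in> A \<union> B" and E: "E \<inter> A \<noteq> {}" "E \<inter> {a, y} = {}"
  shows "block_weight B (insert {a, y} M) E = block_weight (B - {a, y}) M E"
proof -
  have "\<not> (\<exists>p\<in>{a, y}. \<exists>q\<in>{a, y}. \<forall>z\<in>E. p < z \<and> z < q)" if EB: "E \<inter> B \<noteq> {}"
  proof -
    obtain u v where "u \<in> E" "u \<in> A" "v \<in> E" "v \<in> B" using EB E by auto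
    moreover have "u \<le> a" "a < v" using calculation A AB by auto
    moreover have "y \<in> A \<Longrightarrow> y \<le> a" "y \<in> B \<Longrightarrow> a < y" using A AB by auto
    ultimately show ?thesis using y by fastforce
  qed
  moreover have "E \<inter> (B - {a, y}) = E \<inter> B" using E by auto
  ultimately have "E \<inter> B = {} \<or> (\<exists>F\<in>insert {a, y} M. \<exists>p\<in>F. \<exists>q\<in>F. \<forall>z\<in>E. p < z \<and> z < q) \<longleftrightarrow>
      E \<inter> (B - {a, y}) = {} \<or> (\<exists>F\<in>M. \<exists>p\<in>F. \<exists>q\<in>F. \<forall>z\<in>E. p < z \<and> z < q)"
    by (metis insert_iff)
  then show ?thesis
    unfolding block_weight_def by simp
qed

lemma block_weight_Max:
  assumes A: "a \<in> A" "\<And>z. z \<in> A \<Longrightarrow> z \<le> a" and AB: "\<And>p q. p \<in> A \<Longrightarrow> q \<in> B \<Longrightarrow> p < q"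
    and fin: "finite B" and y: "y \<in> A \<union> B"
    and M: "incomplete_matching ((A \<union> B) - {a, y}) M" "\<forall>E\<in>M. E \<inter> A \<noteq> {}"
  shows "block_weight B (insert {a, y} M) {a, y} =
    (if y = a then indet_x else if y \<in> A \<or> y \<noteq> Max B then - 1 else - indet_c)"
proof -
  have ab: "a < b" "b \<notin> A" if "b \<in> B" for b using that A AB by fastforce+
  have union: "\<Union>M = A \<union> B - {a, y}"
    using M by (simp add: incomplete_matching_def partition_on_def)
  consider "y = a" | "y \<in> A" "y \<noteq> a" | "y \<in> B" "y \<noteq> Max B" | "y \<in> B" "y = Max B"
    using y by blast
  then show ?thesis
  proof cases
    case 3
    \<comment> \<open>The nesting block is the one containing \<open>Max B\<close>: its element in
      \<open>A\<close> is below \<open>a\<close>, because \<open>a\<close> is the largest of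
      \<open>A\<close> and already used, and \<open>Max B\<close> is above \<open>y\<close>.\<close>
    have m: "Max B \<in> B" "y < Max B" using 3 fin Max_ge[of B y] by (metis Max_in empty_iff, metis le_neq_implies_less)
    then have "Max B \<in> \<Union>M" using union ab[of "Max B"] by auto
    then obtain F where F: "F \<in> M" "Max B \<in> F" by auto
    then obtain p where p: "p \<in> F" "p \<in> A" using M by auto
    then have "p \<noteq> a" using union F by auto
    then have "p < a" using A p by (simp add: le_neq_implies_less)
    then have "\<forall>z\<in>{a, y}. p < z \<and> z < Max B" using m ab[of y] ab[of "Max B"] 3 by auto
    then have "\<exists>F\<in>M. \<exists>p\<in>F. \<exists>q\<in>F. \<forall>z\<in>{a, y}. p < z \<and> z < q"
      using F p by blast
    then have "\<exists>F\<in>insert {a, y} M. \<exists>p\<in>F. \<exists>q\<in>F. \<forall>z\<in>{a, y}. p < z \<and> z < q"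
      by blast
    moreover have "card {a, y} \<noteq> 1" using ab(1)[of y] 3 by (simp add: card_insert_if)
    ultimately show ?thesis using ab[of y] 3 unfolding block_weight_def by auto
  next
    case 4
    \<comment> \<open>Here \<open>y\<close> is the largest vertex of all, so no block reaches beyond
      it.\<close>
    have "q \<le> y" if "q \<in> F" "F \<in> insert {a, y} M" for q F
    proof -
      have "q \<in> A \<union> B" using that union A y by auto
      then show ?thesis using fin 4 A ab[of y] by (auto intro: less_imp_le order_trans)
    qed
    then have "\<not> (\<exists>F\<in>insert {a, y} M. \<exists>p\<in>F. \<exists>q\<in>F. \<forall>z\<in>{a, y}. p < z \<and> z < q)"
      by (meson insertCI leD)
    moreover have "card {a, y} \<noteq> 1" using ab(1)[OF 4(1)] by (simp add: card_insert_if)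
    ultimately show ?thesis using ab[of y] 4 unfolding block_weight_def by auto
  qed (use ab A in \<open>auto simp: block_weight_def\<close>)
qed

text \<open>Splitting off the block of \<open>Max A\<close> leaves the weights of the other blocks
  intact, so its weight factors out. The sets are arbitrary rather than intervals because the
  removal leaves gaps, and the induction is strong because an edge inside \<open>A\<close> uses up
  two of its elements.\<close>

lemma sum_crossing_matchings:
  assumes "finite A" "finite B" "\<And>p q. p \<in> A \<Longrightarrow> q \<in> B \<Longrightarrow> p < q"
  shows "(\<Sum>M | incomplete_matching (A \<union> B) M \<and> (\<forall>E\<in>M. E \<inter> A \<noteq> {}).
      \<Prod>E\<in>M. block_weight B M E) = crossing_gf (card A) (card B)"
  using assms
proof (induction "card A" arbitrary: A B rule: less_induct)
  case less
  show ?case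
  proof (cases "A = {}")
    case True
    have "{M. incomplete_matching (A \<union> B) M \<and> (\<forall>E\<in>M. E \<inter> A \<noteq> {})} = (if B = {} then {{}} else {})"
      using True by (auto simp: incomplete_matching_def partition_on_def)
    then show ?thesis using True less.prems by auto
  next
    case False
    define a where "a = Max A"
    have A: "a \<in> A" "\<And>z. z \<in> A \<Longrightarrow> z \<le> a" using False less.prems by (auto simp: a_def)
    have ab: "a < b" "b \<notin> A" if "b \<in> B" for b using that A less.prems by fastforce+
    obtain p where p: "card A = Suc p" using A less.prems by (metis card_Suc_Diff1)
    let ?w = "\<lambda>y. if y = a then indet_x else if y \<in> A \<or> y \<noteq> Max B then - 1 else - indet_c
      :: 'a poly poly"
    have "(\<Sum>M | incomplete_matching (A \<union> B) M \<and> (\<forall>E\<in>M. E \<inter> A \<noteq> {}).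
        \<Prod>E\<in>M. block_weight B M E :: 'a poly poly) =
      (\<Sum>y\<in>A \<union> B. \<Sum>M | incomplete_matching (A \<union> B - {a, y}) M
          \<and> (\<forall>E\<in>insert {a, y} M. E \<inter> A \<noteq> {}).
        \<Prod>E\<in>insert {a, y} M. block_weight B (insert {a, y} M) E)"
      using less.prems A by (intro sum_incomplete_matching_split) auto
    also have "\<dots> = (\<Sum>y\<in>A \<union> B. ?w y * crossing_gf (card (A - {a, y})) (card (B - {a, y})))"
    proof (rule sum.cong[OF refl])
      fix y assume y: "y \<in> A \<union> B"
      have un: "A \<union> B - {a, y} = (A - {a, y}) \<union> (B - {a, y})" by auto
      \<comment> \<open>The remaining blocks avoid \<open>a\<close> and \<open>y\<close>, so the
        condition of meeting \<open>A\<close> is the same as that of meeting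
        \<open>A - {a, y}\<close>.\<close>
      have meet: "E \<inter> (A - {a, y}) = E \<inter> A" "E \<inter> {a, y} = {}"
        if "incomplete_matching (A \<union> B - {a, y}) M" "E \<in> M" for M E
        using that by (auto simp: incomplete_matching_def partition_on_def)
      have "(\<Sum>M | incomplete_matching (A \<union> B - {a, y}) M
          \<and> (\<forall>E\<in>insert {a, y} M. E \<inter> A \<noteq> {}).
        \<Prod>E\<in>insert {a, y} M. block_weight B (insert {a, y} M) E) =
        (\<Sum>M | incomplete_matching ((A - {a, y}) \<union> (B - {a, y})) M
          \<and> (\<forall>E\<in>M. E \<inter> (A - {a, y}) \<noteq> {}).
        ?w y * (\<Prod>E\<in>M. block_weight (B - {a, y}) M E))"
      proof (rule sum.cong)
        show "{M. incomplete_matching (A \<union> B - {a, y}) M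
            \<and> (\<forall>E\<in>insert {a, y} M. E \<inter> A \<noteq> {})} =
          {M. incomplete_matching ((A - {a, y}) \<union> (B - {a, y})) M
            \<and> (\<forall>E\<in>M. E \<inter> (A - {a, y}) \<noteq> {})}"
          unfolding un[symmetric]
        proof (intro Collect_cong conj_cong refl)
          fix M assume M: "incomplete_matching (A \<union> B - {a, y}) M"
          have "(\<forall>E\<in>M. E \<inter> (A - {a, y}) \<noteq> {}) = (\<forall>E\<in>M. E \<inter> A \<noteq> {})"
            by (intro ball_cong refl) (simp only: meet(1)[OF M])
          then show "(\<forall>E\<in>insert {a, y} M. E \<inter> A \<noteq> {}) = (\<forall>E\<in>M. E \<inter> (A - {a, y}) \<noteq> {})"
            using A by simp
        qed
        fix M assume "M \<in> {M. incomplete_matching ((A - {a, y}) \<union> (B - {a, y})) M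
            \<and> (\<forall>E\<in>M. E \<inter> (A - {a, y}) \<noteq> {})}"
        then have M: "incomplete_matching (A \<union> B - {a, y}) M" "\<forall>E\<in>M. E \<inter> A \<noteq> {}"
          unfolding un[symmetric] by blast+
        have fin: "finite M"
          using M less.prems finite_elements[of "A \<union> B - {a, y}" M]
          by (auto simp: incomplete_matching_def)
        have "{a, y} \<notin> M" using meet[OF M(1), of "{a, y}"] by auto
        then have "(\<Prod>E\<in>insert {a, y} M. block_weight B (insert {a, y} M) E :: 'a poly poly) =
          block_weight B (insert {a, y} M) {a, y} * (\<Prod>E\<in>M. block_weight B (insert {a, y} M) E)"
          using fin by simp
        also have "block_weight B (insert {a, y} M) {a, y} = ?w y"
          using A less.prems y M by (intro block_weight_Max) auto
        also have "(\<Prod>E\<in>M. block_weight B (insert {a, y} M) E)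
            = (\<Prod>E\<in>M. block_weight (B - {a, y}) M E)"
        proof (intro prod.cong refl)
          fix E assume E: "E \<in> M"
          have "E \<inter> A \<noteq> {}" using M E by blast
          then show "block_weight B (insert {a, y} M) E = block_weight (B - {a, y}) M E"
            using A less.prems(3) y meet(2)[OF M(1) E]
            by (intro block_weight_insert[where A = A]) blast+
        qed
        finally show "(\<Prod>E\<in>insert {a, y} M. block_weight B (insert {a, y} M) E) =
          ?w y * (\<Prod>E\<in>M. block_weight (B - {a, y}) M E)" .
      qed
      also have "\<dots> = ?w y * crossing_gf (card (A - {a, y})) (card (B - {a, y}))"
        unfolding sum_distrib_left[symmetric]
      proof (subst less.hyps)
        show "card (A - {a, y}) < card A"
          using A(1) less.prems(1) by (intro psubset_card_mono) auto
      qed (use less.prems in auto)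
      finally show "(\<Sum>M | incomplete_matching (A \<union> B - {a, y}) M
          \<and> (\<forall>E\<in>insert {a, y} M. E \<inter> A \<noteq> {}).
        \<Prod>E\<in>insert {a, y} M. block_weight B (insert {a, y} M) E) =
        ?w y * crossing_gf (card (A - {a, y})) (card (B - {a, y}))" .
    qed
    \<comment> \<open>The three terms come from \<open>y = a\<close>, from the \<open>p\<close>
      partners inside \<open>A\<close>, and from the partners in \<open>B\<close>.\<close>
    also have "\<dots> = indet_x * crossing_gf p (card B)
        + (\<Sum>y\<in>A - {a}. - crossing_gf (p - 1) (card B))
        + (\<Sum>y\<in>B. ?w y * crossing_gf p (card B - 1))"
    proof -
      let ?t = "\<lambda>y. ?w y * crossing_gf (card (A - {a, y})) (card (B - {a, y})) :: 'a poly poly"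
      have B: "A - {a, y} = A - {a}" "B - {a, y} = B - {y}" if "y \<in> B" for y
        using that ab A by auto
      have BA: "B - {a, y} = B" if "y \<in> A" for y using that ab A by auto
      have cA: "card (A - {a}) = p" using p A less.prems by simp
      have cA': "card (A - {a, y}) = p - 1" if "y \<in> A - {a}" for y
        using p A less.prems(1) that by (simp add: card_Diff_subset)
      have "(\<Sum>y\<in>A \<union> B. ?t y) = (\<Sum>y\<in>A. ?t y) + (\<Sum>y\<in>B. ?t y)"
        using less.prems(1,2) ab by (intro sum.union_disjoint) auto
      also have "(\<Sum>y\<in>A. ?t y) = ?t a + (\<Sum>y\<in>A - {a}. ?t y)"
        using less.prems(1) A(1) by (rule sum.remove)
      also have "?t a = indet_x * crossing_gf p (card B)"
        using cA BA[OF A(1)] by simp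
      also have "(\<Sum>y\<in>A - {a}. ?t y) = (\<Sum>y\<in>A - {a}. - crossing_gf (p - 1) (card B))"
        using cA' BA by (intro sum.cong refl) simp
      also have "(\<Sum>y\<in>B. ?t y) = (\<Sum>y\<in>B. ?w y * crossing_gf p (card B - 1))"
        using B cA less.prems(2) by (intro sum.cong refl) simp
      finally show ?thesis .
    qed
    \<comment> \<open>\<open>Max B\<close> contributes \<open>- indet_c\<close>; each of the
      \<open>r\<close> other elements of \<open>B\<close> contributes \<open>- 1\<close>.\<close>
    also have "(\<Sum>y\<in>B. ?w y * crossing_gf p (card B - 1)) =
      - (case card B of 0 \<Rightarrow> 0 | Suc r \<Rightarrow> (of_nat r + indet_c) * crossing_gf p r)"
    proof (cases "B = {}")
      case False
      then have m: "Max B \<in> B" using less.prems by simp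
      obtain r where r: "card B = Suc r" using m less.prems by (metis card_Suc_Diff1)
      have "(\<Sum>y\<in>B. ?w y * crossing_gf p (card B - 1)) =
        ?w (Max B) * crossing_gf p r + (\<Sum>y\<in>B - {Max B}. ?w y * crossing_gf p r)"
        using m less.prems r by (simp add: sum.remove)
      also have "?w (Max B) = - indet_c" using ab m by auto
      also have "(\<Sum>y\<in>B - {Max B}. ?w y * crossing_gf p r)
        = (\<Sum>y\<in>B - {Max B}. - crossing_gf p r)"
        using ab by (intro sum.cong refl) auto
      also have "\<dots> = - (of_nat r * crossing_gf p r)" using m r less.prems by simp
      finally show ?thesis using r by (simp add: algebra_simps)
    qed simp
    finally show ?thesis using p A less.prems by simp
  qed
qed

section \<open>Matchings with the fake edge put back\<close>

text \<open>Merges the products over fixed points and edges into one product over blocks, to be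
  compared with \<open>block_weight\<close>; a two-element block is the edge from its minimum to its
  maximum.\<close>

lemma matching_weight_eq_prod:
  assumes "finite V" "incomplete_matching V M"
  shows "matching_weight M =
    (\<Prod>E\<in>M. if card E = 1 then indet_x else edge_weight M (Min E, Max E))"
proof -
  let ?S = "{E\<in>M. card E = 1}" and ?P = "{E\<in>M. card E = 2}"
  have fin: "finite M"
    using assms finite_elements[of V M] by (simp add: incomplete_matching_def)
  have "?S = (\<lambda>v. {v}) ` fixed_points M"
    by (auto simp: fixed_points_def card_1_singleton_iff)
  then have 1: "(\<Prod>E\<in>?S. indet_x :: 'a poly poly) = (\<Prod>v\<in>fixed_points M. indet_x)"
    by (simp add: card_image)
  have P: "?P = (\<lambda>(a, b). {a, b}) ` edges M"
  proof (intro equalityI subsetI)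
    fix E assume "E \<in> ?P"
    then obtain a b where "E = {a, b}" "a < b" "E \<in> M"
      by (auto simp: card_2_iff) (metis insert_commute nat_neq_iff)
    then show "E \<in> (\<lambda>(a, b). {a, b}) ` edges M" by (auto simp: edges_def intro!: image_eqI)
  qed (auto simp: edges_def)
  have "inj_on (\<lambda>(a, b). {a, b}) (edges M)"
    by (auto simp: inj_on_def edges_def doubleton_eq_iff)
  then have 2: "(\<Prod>E\<in>?P. edge_weight M (Min E, Max E) :: 'a poly poly)
      = (\<Prod>e\<in>edges M. edge_weight M e)"
    unfolding P by (subst prod.reindex) (auto simp: edges_def intro!: prod.cong)
  have "M = ?S \<union> ?P" using assms by (auto simp: incomplete_matching_def)
  then have "(\<Prod>E\<in>M. if card E = 1 then indet_x else edge_weight M (Min E, Max E) :: 'a poly poly)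
    = (\<Prod>E\<in>?S \<union> ?P. if card E = 1 then indet_x else edge_weight M (Min E, Max E))"
    by simp
  also have "\<dots> = (\<Prod>E\<in>?S. indet_x) * (\<Prod>E\<in>?P. edge_weight M (Min E, Max E))"
    using fin by (subst prod.union_disjoint) (auto intro!: arg_cong2[where f = "(*)"] prod.cong)
  finally show ?thesis unfolding matching_weight_def 1 2 by simp
qed

text \<open>An edge crosses or is nested by \<open>(1, k)\<close> exactly when its left end lies
  strictly between \<open>1\<close> and \<open>k\<close>, since no vertex precedes \<open>1\<close>.
  Connectedness then follows.\<close>

lemma insert_fake_edge_in_hermite_matchings_iff:
  assumes k: "2 \<le> k" "k \<le> n + 2" and M: "incomplete_matching ({1..n + 2} - {1, k}) M"
  shows "insert {1, k} M \<in> hermite_matchings n \<longleftrightarrow> (\<forall>E\<in>M. E \<inter> {2..<k} \<noteq> {})"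
proof -
  let ?M = "insert {1, k} M"
  have un: "\<Union>M = {1..n + 2} - {1, k}"
    using M by (simp add: incomplete_matching_def partition_on_def)
  have card: "card E = 1 \<or> card E = 2" if "E \<in> M" for E
    using M that by (simp add: incomplete_matching_def)
  have inc: "incomplete_matching {1..n + 2} ?M"
    by (rule incomplete_matching_insert) (use k M in auto)
  have one: "1 \<notin> E" "k \<notin> E" if "E \<in> M" for E using un that by auto
  have fake: "(1, k) \<in> edges ?M" using k by (simp add: edges_def)
  \<comment> \<open>Vertex \<open>1\<close> lies in no block of \<open>M\<close>, so the edge
    \<open>f\<close> in \<open>hermite_matchings\<close> can only be \<open>(1, k)\<close>.\<close>
  have fake_unique: "f = (1, k)" if "f \<in> edges ?M" "contains_one f" for f
  proof -
    obtain a b where f: "f = (a, b)" "a < b" "{a, b} \<in> ?M"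
      using \<open>f \<in> edges ?M\<close> by (auto simp: edges_def)
    then have "1 \<in> {a, b}" using that by auto
    then have "{a, b} = {1, k}" using f one(1)[of "{a, b}"] by auto
    then show ?thesis using f k by (auto simp: doubleton_eq_iff)
  qed
  have fixed: "v \<in> fixed_points ?M \<longleftrightarrow> {v} \<in> M" for v
    using k by (auto simp: fixed_points_def)
  have edge: "(a, b) \<in> edges ?M - {(1, k)} \<longleftrightarrow> a < b \<and> {a, b} \<in> M" for a b
    using k one(1)[of "{1, k}"] by (auto simp: edges_def doubleton_eq_iff)
  have "(\<forall>v\<in>fixed_points ?M. nests_vertex (1, k) v) \<and>
      (\<forall>e\<in>edges ?M - {(1, k)}. crosses e (1, k) \<or> nests_edge (1, k) e)
    \<longleftrightarrow> (\<forall>E\<in>M. E \<inter> {2..<k} \<noteq> {})" (is "?L \<longleftrightarrow> ?R")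
  proof
    assume L: ?L
    show ?R
    proof
      fix E assume E: "E \<in> M"
      from card[OF E] show "E \<inter> {2..<k} \<noteq> {}"
      proof
        assume "card E = 1"
        then obtain v where v: "E = {v}" by (auto simp: card_1_singleton_iff)
        then have "nests_vertex (1, k) v" using L E fixed by auto
        then show ?thesis using v by auto
      next
        assume "card E = 2"
        then obtain a b where ab: "E = {a, b}" "a < b"
          by (auto simp: card_2_iff) (metis insert_commute nat_neq_iff)
        then have e: "(a, b) \<in> edges ?M - {(1, k)}" using E edge by auto
        have "a \<in> \<Union>M" using E ab by blast
        then have "a \<ge> 1" unfolding un by auto
        then have "1 < a \<and> a < k" using L[THEN conjunct2, rule_format, OF e] by auto
        then show ?thesis using ab by auto
      qed
    qed
  next
    assume R: ?R
    have "nests_vertex (1, k) v" if "{v} \<in> M" for v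
      using R that by fastforce
    moreover have "crosses e (1, k) \<or> nests_edge (1, k) e" if e: "e \<in> edges ?M - {(1, k)}" for e
    proof -
      obtain a b where ab: "e = (a, b)" by (cases e)
      then have E: "a < b" "{a, b} \<in> M" using e edge by auto
      then have "a \<noteq> 1" "b \<noteq> k" and "a \<in> \<Union>M" using one[of "{a, b}"] by auto
      moreover from this have "a \<ge> 1" unfolding un by simp
      moreover have "a < k" using R E by fastforce
      ultimately show ?thesis using E ab by auto
    qed
    ultimately show ?L using fixed by blast
  qed
  moreover have "connected_matching {1..n + 2} ?M" if R: "\<forall>E\<in>M. E \<inter> {2..<k} \<noteq> {}"
    unfolding connected_matching_def
  proof
    fix v assume "v \<in> {1..n + 2} - {Min {1..n + 2}, Max {1..n + 2}}"
    moreover have "Min {1..n + 2} = 1" "Max {1..n + 2} = n + 2"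
      by (auto intro: Min_eqI Max_eqI)
    ultimately have v: "1 < v" "v < n + 2" by auto
    show "\<exists>e\<in>edges ?M. nests_vertex e v"
    proof (cases "v < k")
      case True
      then show ?thesis using v fake by (intro bexI[of _ "(1, k)"]) auto
    next
      case False
      \<comment> \<open>A vertex \<open>v \<ge> k\<close> is nested by the edge ending at
        \<open>n + 2\<close>, whose other end must lie under the fake edge.\<close>
      then have "n + 2 \<in> {1..n + 2} - {1, k}" using v by auto
      then obtain y where y: "{n + 2, y} \<in> M"
        using incomplete_matching_block[OF M] by blast
      then have "{n + 2, y} \<inter> {2..<k} \<noteq> {}" using R by blast
      then have "y < k" using k by auto
      then have "(y, n + 2) \<in> edges ?M" using y k by (auto simp: edges_def insert_commute)
      then show ?thesis using \<open>y < k\<close> v False by (intro bexI[of _ "(y, n + 2)"]) auto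
    qed
  qed
  ultimately show ?thesis
    unfolding hermite_matchings_def mem_Collect_eq using inc fake fake_unique
    by (metis contains_one.simps)
qed

text \<open>The fake edge nests exactly the other edges with no end beyond \<open>k\<close>, which
  is the clause on \<open>B\<close> in \<open>block_weight\<close>; any other nesting edge is a
  block of \<open>M\<close>.\<close>

lemma matching_weight_insert_fake_edge:
  assumes k: "2 \<le> k" "k \<le> n + 2" and M: "incomplete_matching ({2..<k} \<union> {k<..n + 2}) M"
  shows "matching_weight (insert {1, k} M) = (\<Prod>E\<in>M. block_weight {k<..n + 2} M E)"
proof -
  let ?M = "insert {1, k} M"
  have V: "{1..n + 2} - {1, k} = {2..<k} \<union> {k<..n + 2}" using k by auto
  have "incomplete_matching ({1..n + 2} - {1, k}) M"
    using M unfolding V .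
  then have inc: "incomplete_matching {1..n + 2} ?M"
    by (rule incomplete_matching_insert) (use k in auto)
  have un: "\<Union>M = {2..<k} \<union> {k<..n + 2}"
    using M by (simp add: incomplete_matching_def partition_on_def)
  have card: "card E = 1 \<or> card E = 2" if "E \<in> M" for E
    using M that by (simp add: incomplete_matching_def)
  have fin: "finite M"
    using M finite_elements[of "{2..<k} \<union> {k<..n + 2}" M] by (simp add: incomplete_matching_def)
  have notin: "{1, k} \<notin> M" using un by auto
  have "card {1, k} \<noteq> 1" "Min {1, k} = 1" using k by auto
  then have fake: "(if card {1, k} = 1 then indet_x else edge_weight ?M (Min {1, k}, Max {1, k}))
      = (1 :: 'a poly poly)"
    by (simp add: edge_weight_def)
  have weights: "(if card E = 1 then indet_x else edge_weight ?M (Min E, Max E)) =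
      (block_weight {k<..n + 2} M E :: 'a poly poly)" if E: "E \<in> M" for E
  proof (cases "card E = 1")
    case False
    then have "card E = 2" using card E by blast
    then obtain p q where pq: "E = {p, q}" "p < q"
      by (auto simp: card_2_iff) (metis insert_commute nat_neq_iff)
    have "p \<in> \<Union>M" "q \<in> \<Union>M" using E pq by auto
    then have p1: "1 < p" and q: "q < k \<or> q \<in> {k<..n + 2}" unfolding un using k by auto
    have "nested ?M (p, q) \<longleftrightarrow> (\<exists>r s. {r, s} \<in> ?M \<and> r < p \<and> q < s)"
    proof
      assume "nested ?M (p, q)"
      then obtain e where "e \<in> edges ?M" "nests_edge e (p, q)" unfolding nested_def by blast
      then show "\<exists>r s. {r, s} \<in> ?M \<and> r < p \<and> q < s" by (cases e) (auto simp: edges_def)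
    next
      assume "\<exists>r s. {r, s} \<in> ?M \<and> r < p \<and> q < s"
      then obtain r s where rs: "{r, s} \<in> ?M" "r < p" "q < s" by blast
      then have "(r, s) \<in> edges ?M - {(p, q)}" using pq(2) by (simp add: edges_def)
      moreover have "nests_edge (r, s) (p, q)" using rs pq(2) by simp
      ultimately show "nested ?M (p, q)" unfolding nested_def by blast
    qed
    also have "\<dots> \<longleftrightarrow> E \<inter> {k<..n + 2} = {} \<or>
        (\<exists>F\<in>M. \<exists>r\<in>F. \<exists>s\<in>F. \<forall>z\<in>E. r < z \<and> z < s)" (is "?L \<longleftrightarrow> ?B \<or> ?R")
    proof
      assume ?L
      then obtain r s where rs: "{r, s} \<in> ?M" "r < p" "q < s" by blast
      show "?B \<or> ?R"
      proof (cases "{r, s} = {1, k}")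
        case True
        then have "q < k" using rs pq p1 k by (auto simp: doubleton_eq_iff)
        then show ?thesis using pq by auto
      next
        case False
        then have "{r, s} \<in> M" using rs by auto
        moreover have "\<forall>z\<in>E. r < z \<and> z < s" using rs pq by auto
        ultimately have ?R by blast
        then show ?thesis ..
      qed
    next
      assume "?B \<or> ?R"
      then show ?L
      proof
        assume ?B
        then have "q < k" using q pq by auto
        then show ?thesis using p1 by blast
      next
        assume ?R
        then obtain F r s where F: "F \<in> M" "r \<in> F" "s \<in> F" "r < p" "q < s" using pq by auto
        then have "r \<noteq> s" using pq by auto
        \<comment> \<open>\<open>F\<close> has at most two elements and
          \<open>r \<noteq> s\<close>.\<close>
        then have "F = {r, s}" using card[OF F(1)] F by (auto simp: card_1_singleton_iff card_2_iff)
        then show ?thesis using F by blast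
      qed
    qed
    finally have "nested ?M (p, q) \<longleftrightarrow> ?B \<or> ?R" .
    moreover have "Min E = p" "Max E = q" using pq by auto
    ultimately show ?thesis
      using False p1 pq(2) by (simp add: edge_weight_def block_weight_def)
  qed (simp add: block_weight_def)
  show ?thesis
    unfolding matching_weight_eq_prod[OF finite_atLeastAtMost inc] prod.insert[OF fin notin]
      fake mult_1_left
    by (rule prod.cong[OF refl weights])
qed

section \<open>Summation over the right end of the fake edge\<close>

theorem mainTheorem9:
  fixes n :: nat
  shows "shift_c (assoc_hermite (int n)) =
    (\<Sum>M\<in>hermite_matchings n. matching_weight M :: 'a::comm_ring_1 poly poly)"
proof -
  let ?w = "matching_weight :: nat set set \<Rightarrow> 'a poly poly"
  let ?in = "\<lambda>y M. incomplete_matching ({1..n + 2} - {1, y}) M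
    \<and> insert {1, y} M \<in> hermite_matchings n"
  have "hermite_matchings n = {M. incomplete_matching {1..n + 2} M \<and> M \<in> hermite_matchings n}"
    by (auto simp: hermite_matchings_def)
  then have "(\<Sum>M\<in>hermite_matchings n. ?w M) =
      (\<Sum>M | incomplete_matching {1..n + 2} M \<and> M \<in> hermite_matchings n. ?w M)"
    by (rule sum.cong) (rule refl)
  also have "\<dots> = (\<Sum>y\<in>{1..n + 2}. \<Sum>M | ?in y M. ?w (insert {1, y} M))"
    by (rule sum_incomplete_matching_split) auto
  also have "\<dots> = (\<Sum>y\<in>{2..n + 2}. \<Sum>M | ?in y M. ?w (insert {1, y} M))"
  proof (rule sum.mono_neutral_right)
    \<comment> \<open>The partner \<open>y = 1\<close> would make vertex \<open>1\<close> a fixed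
      point, but it must lie in an edge.\<close>
    have no_edge: "\<not> ?in 1 M" for M
    proof
      assume M: "?in 1 M"
      then obtain a b where ab: "a < b" "{a, b} \<in> insert {1} M" "a = 1 \<or> b = 1"
        by (auto simp: hermite_matchings_def edges_def)
      then have "{a, b} \<in> M" by auto
      then have "1 \<in> \<Union>M" using ab by auto
      then show False using M by (auto simp: incomplete_matching_def partition_on_def)
    qed
    show "\<forall>y\<in>{1..n + 2} - {2..n + 2}. (\<Sum>M | ?in y M. ?w (insert {1, y} M)) = 0"
    proof
      fix y assume "y \<in> {1..n + 2} - {2..n + 2}"
      then have "y = 1" by auto
      then have "{M. ?in y M} = {}" using no_edge by blast
      then show "(\<Sum>M | ?in y M. ?w (insert {1, y} M)) = 0" by (simp only: sum.empty)
    qed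
  qed auto
  also have "\<dots> = (\<Sum>k\<in>{2..n + 2}. crossing_gf (k - 2) (n + 2 - k))"
  proof (rule sum.cong[OF refl])
    fix k assume "k \<in> {2..n + 2}"
    then have k: "2 \<le> k" "k \<le> n + 2" by auto
    have V: "{1..n + 2} - {1, k} = {2..<k} \<union> {k<..n + 2}" using k by auto
    have "(\<Sum>M | ?in k M. ?w (insert {1, k} M)) =
      (\<Sum>M | incomplete_matching ({2..<k} \<union> {k<..n + 2}) M \<and> (\<forall>E\<in>M. E \<inter> {2..<k} \<noteq> {}).
        \<Prod>E\<in>M. block_weight {k<..n + 2} M E)"
    proof (rule sum.cong)
      show "{M. ?in k M} = {M. incomplete_matching ({2..<k} \<union> {k<..n + 2}) M
          \<and> (\<forall>E\<in>M. E \<inter> {2..<k} \<noteq> {})}"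
        unfolding V[symmetric] using insert_fake_edge_in_hermite_matchings_iff[OF k] by blast
    qed (use matching_weight_insert_fake_edge[OF k] in blast)
    also have "\<dots> = crossing_gf (card {2..<k}) (card {k<..n + 2})"
      by (rule sum_crossing_matchings) auto
    finally show "(\<Sum>M | ?in k M. ?w (insert {1, k} M)) = crossing_gf (k - 2) (n + 2 - k)"
      by simp
  qed
  \<comment> \<open>With \<open>q = n + 2 - k\<close> vertices to the right of the fake edge,
    \<open>k - 2 = n - q\<close> lie under it.\<close>
  also have "\<dots> = (\<Sum>q\<le>n. crossing_gf (n - q) q)"
    by (rule sum.reindex_bij_witness[of _ "\<lambda>q. n + 2 - q" "\<lambda>k. n + 2 - k"]) auto
  finally show ?thesis
    by (simp add: shift_c_assoc_hermite_eq_sum)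
qed

end
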